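(* Let $C\in\operatorname{GL}_n(\mathbb{Z})$ be a unitriangular matrix and let $A=C+C^t$. Then the Coxeter matrix $\Phi_C=-C^{-1}C^t$ satisfies $$\Phi_C=r_1^A r_2^A\cdots r_n^A .$$
   Context: A matrix $C\in\operatorname{GL}_n(\mathbb{Z})$ is unitriangular if it is upper triangular and $C_{ii}=1$ for $1\leq i\leq n$. $C^t$ denotes the transpose of $C$. The Coxeter matrix of $C\in\operatorname{GL}_n(\mathbb{Z})$ is $\Phi_C=-C^{-1}C^t$. For an $n\times n$ integer matrix $A$ with $A_{ii}=2$ for all $i$, the reflection $r_i^A$ ($1\leq i\leq n$) is the linear map (matrix) defined on the standard basis $e_1,\dots,e_n$ of $\mathbb{Z}^n$ by $r_i^A(e_j)=e_j-A_{ij}e_i$ for $1\leq j\leq n$. *)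

theory Defs
  imports "Jordan_Normal_Form.Matrix"
begin

text \<open>
  An element of \<open>GL\<^sub>n(\<int>)\<close> is an integer matrix \<open>C \<in> carrier_mat n n\<close> with \<^term>\<open>invertible_mat C\<close>,
  i.e. one having a two-sided inverse with integer entries. Rows, columns and basis vectors are
  indexed by \<open>0, \<dots>, n - 1\<close> instead of \<open>1, \<dots>, n\<close>.
\<close>

definition unitriangular :: "int mat \<Rightarrow> bool" where
  "unitriangular C \<longleftrightarrow> square_mat C \<and> upper_triangular C \<and> (\<forall>i < dim_row C. C $$ (i, i) = 1)"

text \<open>The inverse in \<open>GL\<^sub>n(\<int>)\<close>; meaningful only for \<^term>\<open>invertible_mat C\<close>.\<close>

definition int_mat_inverse :: "int mat \<Rightarrow> int mat" where
  "int_mat_inverse C = (THE B. inverts_mat C B \<and> inverts_mat B C)"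

lemma int_mat_inverse_eqI:
  assumes "inverts_mat C B" "inverts_mat B C"
  shows "int_mat_inverse C = B"
  unfolding int_mat_inverse_def
proof (rule the_equality)
  show "inverts_mat C B \<and> inverts_mat B C" using assms by simp
next
  fix B' assume B': "inverts_mat C B' \<and> inverts_mat B' C"
  have dims: "X \<in> carrier_mat (dim_col C) (dim_row C)"
    if "inverts_mat C X" "inverts_mat X C" for X
  proof (rule carrier_matI)
    have "dim_col (C * X) = dim_row C" "dim_col (X * C) = dim_row X"
      using that unfolding inverts_mat_def by simp_all
    then show "dim_row X = dim_col C" "dim_col X = dim_row C" by simp_all
  qed
  have c: "B \<in> carrier_mat (dim_col C) (dim_row C)" "B' \<in> carrier_mat (dim_col C) (dim_row C)"
    using dims[OF assms] dims B' by blast+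
  have C: "C \<in> carrier_mat (dim_row C) (dim_col C)" by (rule carrier_matI) simp_all
  have "B' = B' * 1\<^sub>m (dim_row C)"
    by (rule right_mult_one_mat[OF c(2), symmetric])
  also have "\<dots> = B' * (C * B)"
    using assms(1) unfolding inverts_mat_def by simp
  also have "\<dots> = (B' * C) * B"
    by (rule assoc_mult_mat[OF c(2) C c(1), symmetric])
  also have "\<dots> = 1\<^sub>m (dim_row B') * B"
    using B' unfolding inverts_mat_def by simp
  also have "\<dots> = B"
    using c by (metis carrier_matD(1) left_mult_one_mat)
  finally show "B' = B" .
qed

definition coxeter_mat :: "int mat \<Rightarrow> int mat" where
  "coxeter_mat C = - int_mat_inverse C * C\<^sup>T"

text \<open>Column \<open>j\<close> of the \<open>i\<close>-th reflection is the image \<open>e\<^sub>j - A\<^sub>i\<^sub>j e\<^sub>i\<close> of the basis vector \<open>e\<^sub>j\<close>.\<close>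

definition reflection_mat :: "int mat \<Rightarrow> nat \<Rightarrow> int mat" where
  "reflection_mat A i = (let n = dim_row A in
     mat_of_cols n (map (\<lambda>j. unit_vec n j - A $$ (i, j) \<cdot>\<^sub>v unit_vec n i) [0..<n]))"

lemma col_reflection_mat:
  assumes "j < dim_row A"
  shows "col (reflection_mat A i) j
    = unit_vec (dim_row A) j - A $$ (i, j) \<cdot>\<^sub>v unit_vec (dim_row A) i"
proof -
  let ?f = "\<lambda>j. unit_vec (dim_row A) j - A $$ (i, j) \<cdot>\<^sub>v unit_vec (dim_row A) i"
  have "map ?f [0..<dim_row A] ! j = ?f j"
    using assms by (simp only: nth_map length_upt nth_upt add_0 diff_zero)
  moreover have "?f j \<in> carrier_vec (dim_row A)"
    by (intro minus_carrier_vec iffD2[OF smult_carrier_vec] unit_vec_carrier)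
  moreover have "j < length (map ?f [0..<dim_row A])"
    using assms by (simp only: length_map length_upt diff_zero)
  ultimately show ?thesis
    unfolding reflection_mat_def Let_def by (simp only: col_mat_of_cols)
qed

text \<open>The ordered product \<open>M\<^sub>1 M\<^sub>2 \<cdots> M\<^sub>k\<close> of a list of \<open>n \<times> n\<close> matrices, leftmost factor first.\<close>

definition mat_prod_list :: "nat \<Rightarrow> int mat list \<Rightarrow> int mat" where
  "mat_prod_list n Ms = foldr (*) Ms (1\<^sub>m n)"

end

theory Submission
  imports Defs
begin

text \<open>
  Left multiplication by \<open>r\<^sub>k\<close> changes only row \<open>k\<close>. Hence row \<open>k\<close> of \<open>P = r\<^sub>1 \<cdots> r\<^sub>n\<close> is determined
  when \<open>r\<^sub>k\<close> is multiplied onto \<open>r\<^bsub>k+1\<^esub> \<cdots> r\<^sub>n\<close>, whose rows up to \<open>k\<close> are still those of the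
  identity, while its later rows are already those of \<open>P\<close>. Since \<open>C\<close> is unitriangular, the
  equation obtained for row \<open>k\<close> of \<open>P\<close> is row \<open>k\<close> of \<open>C P = - C\<^sup>T\<close>.
\<close>

lemma dim_reflection_mat [simp]:
  "dim_row (reflection_mat A i) = dim_row A" "dim_col (reflection_mat A i) = dim_row A"
  by (simp_all add: reflection_mat_def Let_def)

lemma index_reflection_mat:
  assumes "i < dim_row A" "j < dim_row A"
  shows "reflection_mat A k $$ (i, j)
    = (if i = j then 1 else 0) - (if i = k then A $$ (k, j) else 0)"
proof -
  have "reflection_mat A k $$ (i, j) = col (reflection_mat A k) j $ i"
    using assms by simp
  then show ?thesis
    using assms by (simp add: col_reflection_mat unit_vec_def)
qed

lemma index_reflection_mat_mult:
  assumes A: "dim_row A = n" and M: "M \<in> carrier_mat n n" and "i < n" "m < n"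
  shows "(reflection_mat A k * M) $$ (i, m)
    = M $$ (i, m) - (if i = k then \<Sum>j<n. A $$ (k, j) * M $$ (j, m) else 0)"
proof -
  have "(reflection_mat A k * M) $$ (i, m)
      = (\<Sum>j<n. reflection_mat A k $$ (i, j) * M $$ (j, m))"
    using assms by (simp add: scalar_prod_def lessThan_atLeast0)
  also have "\<dots> = (\<Sum>j<n. (if i = j then M $$ (j, m) else 0)
      - (if i = k then A $$ (k, j) * M $$ (j, m) else 0))"
    using A \<open>i < n\<close> by (intro sum.cong) (auto simp: index_reflection_mat algebra_simps)
  also have "\<dots> = M $$ (i, m) - (if i = k then \<Sum>j<n. A $$ (k, j) * M $$ (j, m) else 0)"
    using \<open>i < n\<close> by (simp add: sum_subtractf)
  finally show ?thesis .
qed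

lemma mat_prod_list_Cons: "mat_prod_list n (M # Ms) = M * mat_prod_list n Ms"
  by (simp add: mat_prod_list_def)

text \<open>Downward induction on \<open>k\<close> prepends one reflection at a time, starting from
  the empty product. Starting the sum at \<open>j = i\<close> loses nothing, as \<open>C\<close> is
  upper triangular, and lets the equation for row \<open>i\<close> involve only rows from
  \<open>i\<close> on, which no later factor \<open>reflection_mat A k\<close> with
  \<open>k < i\<close> changes.\<close>

lemma reflection_suffix_product:
  fixes C :: "int mat" and n :: nat
  defines "A \<equiv> C + C\<^sup>T"
  defines "P \<equiv> \<lambda>k. mat_prod_list n (map (reflection_mat A) [k..<n])"
  assumes C: "C \<in> carrier_mat n n" and uni: "unitriangular C" and "k \<le> n"
  shows "P k \<in> carrier_mat n n
    \<and> (\<forall>m<n. \<forall>i<k. P k $$ (i, m) = (if i = m then 1 else 0))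
    \<and> (\<forall>m<n. \<forall>i\<in>{k..<n}. (\<Sum>j=i..<n. C $$ (i, j) * P k $$ (j, m)) = - C $$ (m, i))"
  using \<open>k \<le> n\<close>
proof (induction k rule: inc_induct)
  case base
  then show ?case
    by (auto simp: P_def mat_prod_list_def)
next
  case (step k)
  have A: "dim_row A = n"
    using C by (simp add: A_def)
  have carrier: "P (Suc k) \<in> carrier_mat n n"
    and unit: "\<And>m i. m < n \<Longrightarrow> i \<le> k \<Longrightarrow> P (Suc k) $$ (i, m) = (if i = m then 1 else 0)"
    and rest: "\<And>m i. m < n \<Longrightarrow> k < i \<Longrightarrow> i < n
      \<Longrightarrow> (\<Sum>j=i..<n. C $$ (i, j) * P (Suc k) $$ (j, m)) = - C $$ (m, i)"
    using step.IH by (auto simp: less_Suc_eq_le Suc_le_eq)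
  have Pk: "P k = reflection_mat A k * P (Suc k)"
    using \<open>k < n\<close> by (simp add: P_def upt_conv_Cons mat_prod_list_Cons)
  have entry: "P k $$ (i, m) = P (Suc k) $$ (i, m)
      - (if i = k then \<Sum>j<n. A $$ (k, j) * P (Suc k) $$ (j, m) else 0)"
    if "i < n" "m < n" for i m
    unfolding Pk using index_reflection_mat_mult[OF A carrier that] .
  have lower: "C $$ (i, j) = 0" if "j < i" "i < n" for i j
    using uni that C by (auto simp: unitriangular_def)
  have diag: "C $$ (i, i) = 1" if "i < n" for i
    using uni that C by (auto simp: unitriangular_def)
  have Aentry: "A $$ (k, j) = C $$ (k, j) + C $$ (j, k)" if "j < n" for j
    using that C \<open>k < n\<close> by (simp add: A_def)
  have row_k: "(\<Sum>j=k..<n. C $$ (k, j) * P k $$ (j, m)) = - C $$ (m, k)" if m: "m < n" for m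
  proof -
    let ?Q = "\<lambda>j. P (Suc k) $$ (j, m)"
    \<comment> \<open>For \<open>j < k\<close> row \<open>j\<close> of \<open>P (Suc k)\<close> is
      still a unit row, so only \<open>j = m\<close> can contribute, and \<open>A $$ (k, j)\<close>
      reduces to \<open>C $$ (j, k)\<close>.\<close>
    have low: "(\<Sum>j<k. A $$ (k, j) * ?Q j) = (\<Sum>j<k. if j = m then C $$ (m, k) else 0)"
      using \<open>k < n\<close> m by (intro sum.cong) (auto simp: unit Aentry lower)
    \<comment> \<open>Beyond the diagonal it is the transposed summand of \<open>A\<close> that
      vanishes.\<close>
    have high: "(\<Sum>j=Suc k..<n. A $$ (k, j) * ?Q j) = (\<Sum>j=Suc k..<n. C $$ (k, j) * ?Q j)"
      by (intro sum.cong) (auto simp: Aentry lower)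
    have "(\<Sum>j<n. A $$ (k, j) * ?Q j)
        = (\<Sum>j<k. A $$ (k, j) * ?Q j) + (\<Sum>j=k..<n. A $$ (k, j) * ?Q j)"
      using \<open>k < n\<close> by (simp add: lessThan_atLeast0 sum.atLeastLessThan_concat)
    \<comment> \<open>The coefficient 2 is the diagonal entry of \<open>A\<close>; subtracting it
      from the old entry leaves \<open>- ?Q k\<close> in row \<open>k\<close> of
      \<open>P k\<close>.\<close>
    also have "\<dots> = (if m < k then C $$ (m, k) else 0) + 2 * ?Q k
        + (\<Sum>j=Suc k..<n. C $$ (k, j) * ?Q j)"
      using \<open>k < n\<close> low high by (simp add: sum.atLeast_Suc_lessThan Aentry diag)
    finally have sumA: "(\<Sum>j<n. A $$ (k, j) * ?Q j) = \<dots>" .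
    have "(\<Sum>j=k..<n. C $$ (k, j) * P k $$ (j, m))
        = P k $$ (k, m) + (\<Sum>j=Suc k..<n. C $$ (k, j) * P k $$ (j, m))"
      using \<open>k < n\<close> by (simp add: sum.atLeast_Suc_lessThan diag)
    also have "(\<Sum>j=Suc k..<n. C $$ (k, j) * P k $$ (j, m))
        = (\<Sum>j=Suc k..<n. C $$ (k, j) * ?Q j)"
      using m by (intro sum.cong) (auto simp: entry)
    also have "P k $$ (k, m) = - (if m < k then C $$ (m, k) else 0) - ?Q k
        - (\<Sum>j=Suc k..<n. C $$ (k, j) * ?Q j)"
      using entry[OF \<open>k < n\<close> m] sumA by simp
    finally show ?thesis
      \<comment> \<open>The sums over \<open>j > k\<close> have cancelled, leaving
        \<open>- (if m < k then C $$ (m, k) else 0) - ?Q k\<close>. Row \<open>k\<close> of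
        \<open>P (Suc k)\<close> is a unit row, so \<open>?Q k\<close> supplies the diagonal case
        \<open>m = k\<close>; for \<open>m > k\<close> both sides are 0.\<close>
      using m \<open>k < n\<close> by (cases m k rule: linorder_cases) (auto simp: unit diag lower)
  qed
  have "(\<Sum>j=i..<n. C $$ (i, j) * P k $$ (j, m)) = - C $$ (m, i)"
    if "m < n" "i \<in> {k..<n}" for m i
  proof (cases "i = k")
    case True
    then show ?thesis using row_k that by simp
  next
    case False
    \<comment> \<open>Here \<open>i > k\<close>, so the sum never meets row \<open>k\<close>, the
      only row that changed.\<close>
    then have "(\<Sum>j=i..<n. C $$ (i, j) * P k $$ (j, m))
        = (\<Sum>j=i..<n. C $$ (i, j) * P (Suc k) $$ (j, m))"
      using that by (intro sum.cong) (auto simp: entry)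
    then show ?thesis using False that by (simp add: rest)
  qed
  moreover have "P k \<in> carrier_mat n n"
    using A carrier by (auto simp: Pk)
  moreover have "P k $$ (i, m) = (if i = m then 1 else 0)" if "m < n" "i < k" for m i
    using that \<open>k < n\<close> by (simp add: entry unit)
  ultimately show ?case by blast
qed

lemma unitriangular_mult_reflection_product:
  fixes C :: "int mat" and n :: nat
  assumes C: "C \<in> carrier_mat n n" and uni: "unitriangular C"
  defines "P \<equiv> mat_prod_list n (map (reflection_mat (C + C\<^sup>T)) [0..<n])"
  shows "P \<in> carrier_mat n n" "C * P = - C\<^sup>T"
proof -
  have P: "P \<in> carrier_mat n n"
    and rows: "\<And>i m. i < n \<Longrightarrow> m < n
      \<Longrightarrow> (\<Sum>j=i..<n. C $$ (i, j) * P $$ (j, m)) = - C $$ (m, i)"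
    using reflection_suffix_product[OF C uni, of 0] by (auto simp: P_def)
  show "P \<in> carrier_mat n n" by (rule P)
  show "C * P = - C\<^sup>T"
  proof (rule eq_matI)
    fix i m assume "i < dim_row (- C\<^sup>T)" "m < dim_col (- C\<^sup>T)"
    then have i: "i < n" and m: "m < n" using C by auto
    have "(C * P) $$ (i, m) = (\<Sum>j=0..<n. C $$ (i, j) * P $$ (j, m))"
      using C P i m by (simp add: scalar_prod_def)
    \<comment> \<open>The terms with \<open>j < i\<close> lie below the diagonal of
      \<open>C\<close>.\<close>
    also have "\<dots> = (\<Sum>j=i..<n. C $$ (i, j) * P $$ (j, m))"
      using uni C i by (intro sum.mono_neutral_right) (auto simp: unitriangular_def)
    finally show "(C * P) $$ (i, m) = (- C\<^sup>T) $$ (i, m)"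
      using C i m by (simp add: rows)
  qed (use C P in auto)
qed

theorem corollary2p11:
  fixes n :: nat and C A :: "int mat"
  assumes "C \<in> carrier_mat n n"
    and "invertible_mat C"
    and "unitriangular C"
    and "A = C + C\<^sup>T"
  shows "coxeter_mat C = mat_prod_list n (map (reflection_mat A) [0..<n])"
proof -
  let ?P = "mat_prod_list n (map (reflection_mat A) [0..<n])"
  note C = assms(1)
  have P: "?P \<in> carrier_mat n n" and CP: "C * ?P = - C\<^sup>T"
    using unitriangular_mult_reflection_product[OF C assms(3)] assms(4) by simp_all
  obtain B where B: "inverts_mat C B" "inverts_mat B C"
    using assms(2) unfolding invertible_mat_def by blast
  \<comment> \<open>\<open>inverts_mat\<close> does not state the size of \<open>B\<close>; it is
    read off from the identity matrices that the two products equal.\<close>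
  have "dim_col (C * B) = n" "dim_col (B * C) = dim_row B"
    using B C by (simp_all add: inverts_mat_def)
  then have Bc: "B \<in> carrier_mat n n"
    using C by auto
  have "coxeter_mat C = - B * C\<^sup>T"
    by (simp add: coxeter_mat_def int_mat_inverse_eqI[OF B])
  also have "\<dots> = B * (- C\<^sup>T)"
    using Bc C by simp
  also have "\<dots> = (B * C) * ?P"
    unfolding CP[symmetric] by (rule assoc_mult_mat[OF Bc C P, symmetric])
  also have "\<dots> = ?P"
    using B Bc P by (simp add: inverts_mat_def)
  finally show ?thesis .
qed

end
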